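(* Suppose that $A$ and $B$ are loxodromic elements of $\mathrm{SU}(J)$. Let $\mathbb{X}_1,\mathbb{X}_2,\mathbb{X}_3$ be the cross-ratios of their eigenvectors. Write $C=(AB)^{-1}$ and $\sigma_+=\mathrm{tr}(A^{-1}B)-\mathrm{tr}(A^{-1})\mathrm{tr}(B)$. There is a bijection, depending only on the eigenvalues of $A$ and $B$, between $(\lambda_A,\lambda_B,\mathbb{X}_1,\mathbb{X}_2)$ and $(\mathrm{tr}(A),\mathrm{tr}(B),\mathrm{tr}(C),\sigma_+)$; that is, a bijection between the set of values of the first quadruple and the set of values of the second quadruple, as $(A,B)$ varies, which carries the first quadruple of $(A,B)$ to the second quadruple of $(A,B)$ for every such pair. Moreover, fixing the other parameters, the sign of the imaginary part of $\mathbb{X}_3$ is determined by the choice of a root of the commutator quadratic $Q$.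
   Context: $J$ is the $3\times 3$ antidiagonal matrix with all antidiagonal entries $1$; it defines the Hermitian form $\langle\mathbf z,\mathbf w\rangle=\mathbf w^*J\mathbf z$ on $\mathbb{C}^3$ of signature $(2,1)$, and $\mathrm{SU}(J)=\{M\in\mathrm{SL}(3,\mathbb{C}):M^*JM=J\}$. An element of $\mathrm{SU}(J)$ is loxodromic if its eigenvalues $\lambda,\mu,\nu$ satisfy $|\lambda|>|\mu|>|\nu|$ (then $\nu=\overline{\lambda}^{-1}$, $\mu=\lambda^{-1}\overline\lambda$). $\lambda_A$, $\lambda_B$ denote the eigenvalues of largest absolute value of $A$, $B$. Let $\mathbf a_A,\mathbf r_A$ be the attractive and repulsive eigenvectors of $A$ (for the eigenvalues of largest and smallest absolute value), and $\mathbf a_B,\mathbf r_B$ those of $B$. The cross-ratios are $$\mathbb{X}_1=\frac{\langle\mathbf r_A,\mathbf a_B\rangle\langle\mathbf r_B,\mathbf a_A\rangle}{\langle\mathbf r_B,\mathbf a_B\rangle\langle\mathbf r_A,\mathbf a_A\rangle},\quad \mathbb{X}_2=\frac{\langle\mathbf a_A,\mathbf a_B\rangle\langle\mathbf r_B,\mathbf r_A\rangle}{\langle\mathbf r_B,\mathbf a_B\rangle\langle\mathbf a_A,\mathbf r_A\rangle},\quad \mathbb{X}_3=\frac{\langle\mathbf a_B,\mathbf a_A\rangle\langle\mathbf r_B,\mathbf r_A\rangle}{\langle\mathbf r_B,\mathbf a_A\rangle\langle\mathbf a_B,\mathbf r_A\rangle};$$ they are defined when the four fixed points are pairwise distinct,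 which is understood. The modulus and real part of $\mathbb{X}_3$ are determined by $\mathbb{X}_1,\mathbb{X}_2$ through $|\mathbb{X}_2|=|\mathbb{X}_1||\mathbb{X}_3|$ and $2|\mathbb{X}_1|^2\mathrm{Re}(\mathbb{X}_3)=|\mathbb{X}_1|^2+|\mathbb{X}_2|^2+1-2\mathrm{Re}(\mathbb{X}_1+\mathbb{X}_2)$. The commutator quadratic is $Q(X)=X^2-(\mathrm{tr}[A,B]+\mathrm{tr}[B,A])X+\mathrm{tr}[A,B]\,\mathrm{tr}[B,A]$ with $[A,B]=ABA^{-1}B^{-1}$; its coefficients depend only on $\mathrm{tr}(A^{\pm1}),\mathrm{tr}(B^{\pm1}),\mathrm{tr}(C^{\pm1}),\sigma_+$ and $\sigma_-=\overline{\sigma_+}$, its roots are the complex conjugates $\mathrm{tr}[A,B]$ and $\mathrm{tr}[B,A]$, and choosing a root means specifying which root is $\mathrm{tr}[A,B]$. *)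

theory Defs
  imports "HOL-Analysis.Analysis" "HOL-Computational_Algebra.Polynomial"
begin

section \<open>The Hermitian form and the group SU(J)\<close>

definition J_mat :: "complex^3^3" where
  "J_mat = vector [vector [0, 0, 1], vector [0, 1, 0], vector [1, 0, 0]]"

definition adjoint_mat :: "complex^'n^'m \<Rightarrow> complex^'m^'n" where
  "adjoint_mat M = (\<chi> i j. cnj (M $ j $ i))"

text \<open>The form is \<open>w\<^sup>* J z\<close>: linear in the first and conjugate-linear in the second argument.\<close>

definition herm :: "complex^3 \<Rightarrow> complex^3 \<Rightarrow> complex" where
  "herm z w = (\<Sum>i\<in>UNIV. cnj (w $ i) * (J_mat *v z) $ i)"

definition SU_J :: "(complex^3^3) set" where
  "SU_J = {M. det M = 1 \<and> adjoint_mat M ** J_mat ** M = J_mat}"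

section \<open>Loxodromic elements and their fixed points\<close>

definition eigenvector :: "complex^'n^'n \<Rightarrow> complex^'n \<Rightarrow> complex \<Rightarrow> bool" where
  "eigenvector M v l \<longleftrightarrow> v \<noteq> 0 \<and> M *v v = l *s v"

definition eigenvalue :: "complex^'n^'n \<Rightarrow> complex \<Rightarrow> bool" where
  "eigenvalue M l \<longleftrightarrow> (\<exists>v. eigenvector M v l)"

text \<open>Three eigenvalues of distinct moduli are all the eigenvalues of a \<open>3 \<times> 3\<close> matrix, so no
  multiplicities have to be recorded.\<close>

definition loxodromic :: "complex^3^3 \<Rightarrow> bool" where
  "loxodromic M \<longleftrightarrow> M \<in> SU_J \<and>
     (\<exists>l m n. eigenvalue M l \<and> eigenvalue M m \<and> eigenvalue M n \<and>
              cmod l > cmod m \<and> cmod m > cmod n)"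

text \<open>The next two descriptions are uniquely satisfied when \<open>M\<close> is loxodromic, the only case in
  which they are used.\<close>

definition max_eigenvalue :: "complex^3^3 \<Rightarrow> complex" where
  "max_eigenvalue M = (THE l. eigenvalue M l \<and> (\<forall>m. eigenvalue M m \<longrightarrow> cmod m \<le> cmod l))"

definition min_eigenvalue :: "complex^3^3 \<Rightarrow> complex" where
  "min_eigenvalue M = (THE l. eigenvalue M l \<and> (\<forall>m. eigenvalue M m \<longrightarrow> cmod l \<le> cmod m))"

definition attractive :: "complex^3^3 \<Rightarrow> complex^3 \<Rightarrow> bool" where
  "attractive M v \<longleftrightarrow> eigenvector M v (max_eigenvalue M)"

definition repulsive :: "complex^3^3 \<Rightarrow> complex^3 \<Rightarrow> bool" where
  "repulsive M v \<longleftrightarrow> eigenvector M v (min_eigenvalue M)"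

text \<open>The point of the complex projective plane represented by a nonzero vector, as a line.\<close>

definition proj_point :: "complex^3 \<Rightarrow> (complex^3) set" where
  "proj_point v = vec.span {v}"

text \<open>Eigenvectors are determined only up to scaling; instead of fixing representatives, all
  choices are admitted (the cross-ratios do not depend on them).\<close>

definition lox_pair ::
  "complex^3^3 \<Rightarrow> complex^3^3 \<Rightarrow> complex^3 \<Rightarrow> complex^3 \<Rightarrow> complex^3 \<Rightarrow> complex^3 \<Rightarrow> bool" where
  "lox_pair A B aA rA aB rB \<longleftrightarrow>
     loxodromic A \<and> loxodromic B \<and>
     attractive A aA \<and> repulsive A rA \<and> attractive B aB \<and> repulsive B rB \<and>
     distinct [proj_point aA, proj_point rA, proj_point aB, proj_point rB]"

section \<open>Cross-ratios, traces and the commutator quadratic\<close>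

definition X1 :: "complex^3 \<Rightarrow> complex^3 \<Rightarrow> complex^3 \<Rightarrow> complex^3 \<Rightarrow> complex" where
  "X1 aA rA aB rB = (herm rA aB * herm rB aA) / (herm rB aB * herm rA aA)"

definition X2 :: "complex^3 \<Rightarrow> complex^3 \<Rightarrow> complex^3 \<Rightarrow> complex^3 \<Rightarrow> complex" where
  "X2 aA rA aB rB = (herm aA aB * herm rB rA) / (herm rB aB * herm aA rA)"

definition X3 :: "complex^3 \<Rightarrow> complex^3 \<Rightarrow> complex^3 \<Rightarrow> complex^3 \<Rightarrow> complex" where
  "X3 aA rA aB rB = (herm aB aA * herm rB rA) / (herm rB aA * herm aB rA)"

definition sigma_plus :: "complex^3^3 \<Rightarrow> complex^3^3 \<Rightarrow> complex" where
  "sigma_plus A B = trace (matrix_inv A ** B) - trace (matrix_inv A) * trace B"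

definition cross_ratio_params ::
  "complex^3^3 \<Rightarrow> complex^3^3 \<Rightarrow> complex^3 \<Rightarrow> complex^3 \<Rightarrow> complex^3 \<Rightarrow> complex^3 \<Rightarrow>
   complex \<times> complex \<times> complex \<times> complex" where
  "cross_ratio_params A B aA rA aB rB =
     (max_eigenvalue A, max_eigenvalue B, X1 aA rA aB rB, X2 aA rA aB rB)"

definition trace_params ::
  "complex^3^3 \<Rightarrow> complex^3^3 \<Rightarrow> complex \<times> complex \<times> complex \<times> complex" where
  "trace_params A B = (trace A, trace B, trace (matrix_inv (A ** B)), sigma_plus A B)"

definition cross_ratio_values :: "(complex \<times> complex \<times> complex \<times> complex) set" where
  "cross_ratio_values =
     {cross_ratio_params A B aA rA aB rB | A B aA rA aB rB. lox_pair A B aA rA aB rB}"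

definition trace_values :: "(complex \<times> complex \<times> complex \<times> complex) set" where
  "trace_values = {trace_params A B | A B aA rA aB rB. lox_pair A B aA rA aB rB}"

definition commutator :: "complex^3^3 \<Rightarrow> complex^3^3 \<Rightarrow> complex^3^3" where
  "commutator A B = A ** B ** matrix_inv A ** matrix_inv B"

definition commutator_quadratic :: "complex^3^3 \<Rightarrow> complex^3^3 \<Rightarrow> complex poly" where
  "commutator_quadratic A B =
     [: trace (commutator A B) * trace (commutator B A),
        - (trace (commutator A B) + trace (commutator B A)), 1 :]"

end

theory Submission
  imports Defs
begin

text \<open>Normalize a loxodromic \<open>A\<close> with eigenvalues \<open>l, m, n\<close> by \<open>\<langle>a, r\<rangle> = 1\<close>; then
  \<open>A v = m v + (l - m) \<langle>v, r\<rangle> a + (n - m) \<langle>v, a\<rangle> r\<close>, where \<open>m = cnj l / l\<close> and \<open>n = 1 / cnj l\<close>. Hence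
  \<open>tr(AB)\<close> and \<open>tr(A\<^sup>-\<^sup>1B)\<close> are real-affine in \<open>(X\<^sub>1, X\<^sub>2)\<close> with coefficients depending on the
  eigenvalues. Writing \<open>w(l) = |l - m|\<^sup>2 - |n - m|\<^sup>2\<close>, this real-linear system is nonsingular because
  \<open>w(l)\<close> and \<open>w(k)\<close> are nonzero, where \<open>l, k\<close> are the leading eigenvalues of \<open>A, B\<close>; these in turn are
  the only roots outside the unit disc of characteristic polynomials determined by the traces.

  The same trace formula applied to \<open>A\<close> and \<open>B A\<^sup>-\<^sup>1 B\<^sup>-\<^sup>1\<close> gives
  \<open>Im tr[A, B] = - w(l) w(k) |X\<^sub>1|\<^sup>2 Im X\<^sub>3\<close> with \<open>w(l), w(k) > 0\<close>, while \<open>Re tr[A, B]\<close> involves \<open>X\<^sub>3\<close> only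
  through its real part, which \<open>X\<^sub>1, X\<^sub>2\<close> determine. So the sign of \<open>Im X\<^sub>3\<close> is opposite to that of
  \<open>Im tr[A, B]\<close>, and the commutator quadratic is determined by the other parameters.\<close>

section \<open>The Hermitian form\<close>

lemma herm_expand: "herm z w = z $ 3 * cnj (w $ 1) + z $ 2 * cnj (w $ 2) + z $ 1 * cnj (w $ 3)"
  by (simp add: herm_def J_mat_def matrix_vector_mult_def sum_3 mult.commute)

lemma herm_add: "herm (u + v) w = herm u w + herm v w" "herm w (u + v) = herm w u + herm w v"
  by (simp_all add: herm_expand algebra_simps)

lemma herm_diff: "herm (u - v) w = herm u w - herm v w" "herm w (u - v) = herm w u - herm w v"
  by (simp_all add: herm_expand algebra_simps)

lemma herm_scale: "herm (c *s u) w = c * herm u w" "herm w (c *s u) = cnj c * herm w u"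
  by (simp_all add: herm_expand algebra_simps)

lemmas herm_linear = herm_add herm_diff herm_scale

lemma herm_cnj: "cnj (herm u v) = herm v u"
  by (simp add: herm_expand algebra_simps)

lemma herm_nondegenerate:
  assumes "\<And>w. herm v w = 0"
  shows "v = 0"
  using assms[of "axis 1 1"] assms[of "axis 2 1"] assms[of "axis 3 1"]
  by (simp add: herm_expand axis_def vec_eq_iff forall_3)

lemma SU_J_herm:
  assumes "A \<in> SU_J"
  shows "herm (A *v z) (A *v w) = herm z w"
proof -
  have "herm (A *v z) (A *v w) = (\<Sum>j\<in>UNIV. cnj (w $ j) * ((adjoint_mat A ** J_mat ** A) *v z) $ j)"
    unfolding herm_def matrix_vector_mul_assoc[symmetric]
    by (simp add: adjoint_mat_def matrix_vector_mult_def[of A w]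
        matrix_vector_mult_def[of "\<chi> i j. cnj (A $ j $ i)"] sum_3 algebra_simps)
  then show ?thesis
    using assms by (simp add: SU_J_def herm_def)
qed


section \<open>Adjoints, inverses and traces in SU(J)\<close>

lemma adjoint_mat_mult: "adjoint_mat (A ** B) = adjoint_mat B ** adjoint_mat A"
  by (simp add: adjoint_mat_def matrix_matrix_mult_def vec_eq_iff mult.commute)

lemma SU_J_mult:
  assumes "A \<in> SU_J" "B \<in> SU_J"
  shows "A ** B \<in> SU_J"
proof -
  have "adjoint_mat (A ** B) ** J_mat ** (A ** B)
      = adjoint_mat B ** (adjoint_mat A ** J_mat ** A) ** B"
    by (simp add: adjoint_mat_mult matrix_mul_assoc)
  with assms show ?thesis
    by (simp add: SU_J_def det_mul)
qed

lemma J_mat_involution: "J_mat ** J_mat = mat 1"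
  by (simp add: J_mat_def matrix_matrix_mult_def mat_def vec_eq_iff forall_3 sum_3)

lemma matrix_inv_eqI:
  fixes A B :: "complex^'n^'n"
  assumes "B ** A = mat 1"
  shows "matrix_inv A = B"
proof -
  have "A ** B = mat 1"
    using assms matrix_left_right_inverse by blast
  then have "A ** matrix_inv A = mat 1 \<and> matrix_inv A ** A = mat 1"
    unfolding matrix_inv_def using assms by (metis (mono_tags, lifting) someI)
  then have "B ** (A ** matrix_inv A) = B"
    by simp
  with assms show ?thesis
    by (simp add: matrix_mul_assoc)
qed

lemma SU_J_inv_left:
  assumes "A \<in> SU_J"
  shows "J_mat ** adjoint_mat A ** J_mat ** A = mat 1"
proof -
  have "J_mat ** adjoint_mat A ** J_mat ** A = J_mat ** (adjoint_mat A ** J_mat ** A)"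
    by (simp add: matrix_mul_assoc)
  also have "adjoint_mat A ** J_mat ** A = J_mat"
    using assms by (simp add: SU_J_def)
  finally show ?thesis
    by (simp add: J_mat_involution)
qed

lemma SU_J_inv:
  assumes "A \<in> SU_J"
  shows "matrix_inv A = J_mat ** adjoint_mat A ** J_mat"
  by (rule matrix_inv_eqI[OF SU_J_inv_left[OF assms]])

text \<open>The inverse is the adjoint conjugated by the involution \<open>J_mat\<close>, and the
  trace is cyclic. This expresses \<open>tr(C)\<close> through \<open>tr(AB)\<close>.\<close>

lemma trace_SU_J_inv:
  assumes "A \<in> SU_J"
  shows "trace (matrix_inv A) = cnj (trace A)"
proof -
  have "trace (matrix_inv A) = trace (adjoint_mat A ** (J_mat ** J_mat))"
    using trace_mul_sym[of J_mat "adjoint_mat A ** J_mat"]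
    by (simp add: SU_J_inv[OF assms] matrix_mul_assoc)
  then show ?thesis
    by (simp add: J_mat_involution adjoint_mat_def trace_def)
qed

lemma SU_J_inv_both:
  assumes "A \<in> SU_J"
  shows "matrix_inv A ** A = mat 1" "A ** matrix_inv A = mat 1"
proof -
  show "matrix_inv A ** A = mat 1"
    using SU_J_inv_left[OF assms] by (simp add: SU_J_inv[OF assms])
  then show "A ** matrix_inv A = mat 1"
    using matrix_left_right_inverse by blast
qed

section \<open>Matrices with prescribed eigenvalues and fixed points\<close>

definition mid_eig :: "complex \<Rightarrow> complex" where
  "mid_eig l = cnj l / l"

definition att_coeff :: "complex \<Rightarrow> complex" where
  "att_coeff l = l - mid_eig l"

definition rep_coeff :: "complex \<Rightarrow> complex" where
  "rep_coeff l = 1 / cnj l - mid_eig l"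

text \<open>If \<open>a\<close>, \<open>r\<close> are null vectors with \<open>herm a r = 1\<close>, this is the element of \<open>SU(J)\<close> with
  eigenvalues \<open>l\<close> on \<open>a\<close>, \<open>1 / cnj l\<close> on \<open>r\<close> and \<open>cnj l / l\<close> on their orthogonal complement. The
  explicit three-component vectors are \<open>J r\<close> and \<open>J a\<close>.\<close>

definition lox_mat :: "complex \<Rightarrow> complex^3 \<Rightarrow> complex^3 \<Rightarrow> complex^3^3" where
  "lox_mat l a r = (\<chi> i j. (if i = j then mid_eig l else 0)
     + att_coeff l * a $ i * cnj (vector [r $ 3, r $ 2, r $ 1] $ j)
     + rep_coeff l * r $ i * cnj (vector [a $ 3, a $ 2, a $ 1] $ j))"

lemma lox_mat_mult:
  "lox_mat l a r *v v =
     mid_eig l *s v + (att_coeff l * herm v r) *s a + (rep_coeff l * herm v a) *s r"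
  by (simp add: lox_mat_def matrix_vector_mult_def sum_3 vec_eq_iff forall_3
      herm_expand algebra_simps)

lemma trace_lox_mat:
  "trace (lox_mat l a r) = 3 * mid_eig l + att_coeff l * herm a r + rep_coeff l * herm r a"
  by (simp add: lox_mat_def trace_def sum_3 herm_expand algebra_simps)

lemma trace_lox_mat_mult_left:
  "trace (lox_mat l a r ** Y) =
     mid_eig l * trace Y + att_coeff l * herm (Y *v a) r + rep_coeff l * herm (Y *v r) a"
  by (simp add: lox_mat_def trace_def matrix_matrix_mult_def matrix_vector_mult_def sum_3
      herm_expand algebra_simps)

lemma trace_lox_mat_mult:
  "trace (lox_mat l a r ** lox_mat k b s) =
     3 * mid_eig l * mid_eig k
     + mid_eig k * (att_coeff l * herm a r + rep_coeff l * herm r a)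
     + mid_eig l * (att_coeff k * herm b s + rep_coeff k * herm s b)
     + att_coeff l * att_coeff k * (herm b r * herm a s)
     + rep_coeff l * rep_coeff k * (herm s a * herm r b)
     + att_coeff l * rep_coeff k * (herm s r * herm a b)
     + rep_coeff l * att_coeff k * (herm b a * herm r s)"
  unfolding trace_lox_mat_mult_left trace_lox_mat lox_mat_mult herm_linear
  by (simp add: algebra_simps)

text \<open>\<open>B\<close> preserves \<open>herm\<close>, so conjugation by it moves only the
  vectors \<open>a\<close> and \<open>r\<close>.\<close>

lemma lox_mat_conj:
  assumes "B \<in> SU_J"
  shows "B ** lox_mat l a r ** matrix_inv B = lox_mat l (B *v a) (B *v r)"
proof -
  have "(B ** lox_mat l a r) *v v = (lox_mat l (B *v a) (B *v r) ** B) *v v" for v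
    by (simp add: matrix_vector_mul_assoc[symmetric] lox_mat_mult SU_J_herm[OF assms]
        matrix_vector_right_distrib vector_scalar_commute)
  then have "B ** lox_mat l a r = lox_mat l (B *v a) (B *v r) ** B"
    by (simp add: matrix_eq)
  then show ?thesis
    by (metis SU_J_inv_both(2)[OF assms] matrix_mul_assoc matrix_mul_rid)
qed

text \<open>Together with \<open>lox_mat_inv\<close>, this lets every trace formula be reused for
  the inverse matrix by putting \<open>1 / l\<close> for \<open>l\<close>.\<close>

lemma coeff_inverse:
  assumes "l \<noteq> 0"
  shows "mid_eig (1 / l) = cnj (mid_eig l)" "att_coeff (1 / l) = cnj (rep_coeff l)"
    "rep_coeff (1 / l) = cnj (att_coeff l)"
  using assms by (simp_all add: mid_eig_def att_coeff_def rep_coeff_def)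

lemma lox_mat_inv:
  assumes "l \<noteq> 0" "herm a a = 0" "herm r r = 0" "herm a r = 1"
  shows "matrix_inv (lox_mat l a r) = lox_mat (1 / l) a r"
proof (rule matrix_inv_eqI)
  have ra: "herm r a = 1"
    using herm_cnj[of a r] assms by simp
  define m p q where "m = mid_eig l" and "p = att_coeff l" and "q = rep_coeff l"
  \<comment> \<open>The last two identities are \<open>(cnj m + cnj q) * (m + p) = 1\<close> and
    \<open>(cnj m + cnj p) * (m + q) = 1\<close> expanded: the eigenvalues on \<open>a\<close> and
    on \<open>r\<close> are inverted.\<close>
  have c: "cnj m * m = 1" "m * cnj m = 1" "cnj m * p + cnj q * m + cnj q * p = 0"
     "cnj m * q + cnj p * m + cnj p * q = 0"
    unfolding m_def p_def q_def att_coeff_def rep_coeff_def mid_eig_def using assms(1)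
    by (simp_all add: field_simps)
  have "(lox_mat (1 / l) a r ** lox_mat l a r) *v v = mat 1 *v v" for v
  proof -
    have "(lox_mat (1 / l) a r ** lox_mat l a r) *v v =
       (cnj m * m) *s v + ((cnj m * p + cnj q * m + cnj q * p) * herm v r) *s a
         + ((cnj m * q + cnj p * m + cnj p * q) * herm v a) *s r"
      using assms ra
      by (simp add: matrix_vector_mul_assoc[symmetric] lox_mat_mult coeff_inverse herm_linear
          m_def[symmetric] p_def[symmetric] q_def[symmetric])
        (simp add: vec_eq_iff algebra_simps)
    then show ?thesis
      by (simp add: c)
  qed
  then show "lox_mat (1 / l) a r ** lox_mat l a r = mat 1"
    by (simp add: matrix_eq)
qed

section \<open>Normal form of a loxodromic matrix\<close>

text \<open>Applying the matrix twice to the relation yields a Vandermonde system in the three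
  terms.\<close>

lemma eigenbasis_independent:
  fixes A :: "complex^'n^'n"
  assumes eig: "eigenvector A a l" "eigenvector A e m" "eigenvector A r n"
    and ne: "l \<noteq> m" "m \<noteq> n" "l \<noteq> n"
    and zero: "x *s a + y *s e + z *s r = 0"
  shows "x = 0 \<and> y = 0 \<and> z = 0"
proof -
  have A: "A *v a = l *s a" "A *v e = m *s e" "A *v r = n *s r"
    and nz: "a \<noteq> 0" "e \<noteq> 0" "r \<noteq> 0"
    using eig by (auto simp: eigenvector_def)
  have step: "A *v (x *s a + y *s e + z *s r) = (x * l) *s a + (y * m) *s e + (z * n) *s r" for x y z
    by (simp add: matrix_vector_right_distrib vector_scalar_commute A)
  have z1: "(x * l) *s a + (y * m) *s e + (z * n) *s r = 0"
    using step[of x y z] zero by simp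
  have z2: "(x * l * l) *s a + (y * m * m) *s e + (z * n * n) *s r = 0"
    using step[of "x * l" "y * m" "z * n"] z1 by simp
  have c: "x * a $ i + y * e $ i + z * r $ i = 0"
    "x * l * a $ i + y * m * e $ i + z * n * r $ i = 0"
    "x * l * l * a $ i + y * m * m * e $ i + z * n * n * r $ i = 0" for i
    using zero z1 z2 by (simp_all add: vec_eq_iff)
  \<comment> \<open>Lagrange interpolation: the polynomial \<open>(t - m) * (t - n)\<close> in the
    matrix annihilates the terms of \<open>e\<close> and \<open>r\<close>; the other two
    combinations are analogous.\<close>
  have "(l - m) * (l - n) * (x * a $ i) =
      (x * l * l * a $ i + y * m * m * e $ i + z * n * n * r $ i)
      - (m + n) * (x * l * a $ i + y * m * e $ i + z * n * r $ i)
      + m * n * (x * a $ i + y * e $ i + z * r $ i)" for i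
    by (simp add: algebra_simps)
  moreover have "(m - l) * (m - n) * (y * e $ i) =
      (x * l * l * a $ i + y * m * m * e $ i + z * n * n * r $ i)
      - (l + n) * (x * l * a $ i + y * m * e $ i + z * n * r $ i)
      + l * n * (x * a $ i + y * e $ i + z * r $ i)" for i
    by (simp add: algebra_simps)
  moreover have "(n - l) * (n - m) * (z * r $ i) =
      (x * l * l * a $ i + y * m * m * e $ i + z * n * n * r $ i)
      - (l + m) * (x * l * a $ i + y * m * e $ i + z * n * r $ i)
      + l * m * (x * a $ i + y * e $ i + z * r $ i)" for i
    by (simp add: algebra_simps)
  ultimately have "(l - m) * (l - n) * (x * a $ i) = 0" "(m - l) * (m - n) * (y * e $ i) = 0"
    "(n - l) * (n - m) * (z * r $ i) = 0" for i
    by (simp_all only: c) simp_all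
  then have "x *s a = 0" "y *s e = 0" "z *s r = 0"
    using ne by (auto simp: vec_eq_iff)
  with nz show ?thesis by simp
qed

definition cols3 :: "complex^3 \<Rightarrow> complex^3 \<Rightarrow> complex^3 \<Rightarrow> complex^3^3" where
  "cols3 a e r = (\<chi> i j. vector [a $ i, e $ i, r $ i] $ j)"

lemma cols3_mult: "cols3 a e r *v x = x $ 1 *s a + x $ 2 *s e + x $ 3 *s r"
  by (simp add: cols3_def matrix_vector_mult_def sum_3 vec_eq_iff forall_3 mult.commute)

lemma eigenbasis_invertible:
  fixes A :: "complex^3^3"
  assumes "eigenvector A a l" "eigenvector A e m" "eigenvector A r n"
    and "l \<noteq> m" "m \<noteq> n" "l \<noteq> n"
  shows "invertible (cols3 a e r)"
proof -
  have "x = 0" if "cols3 a e r *v x = 0" for x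
  proof -
    have "x $ 1 = 0 \<and> x $ 2 = 0 \<and> x $ 3 = 0"
      by (rule eigenbasis_independent[OF assms]) (use that in \<open>simp add: cols3_mult\<close>)
    then show ?thesis
      by (simp add: vec_eq_iff forall_3)
  qed
  then have "\<exists>S. S ** cols3 a e r = mat 1"
    using matrix_left_invertible_ker[of "cols3 a e r"] by simp
  then show ?thesis
    by (simp add: invertible_left_inverse)
qed

lemma eigenbasis_expand:
  fixes A :: "complex^3^3"
  assumes "eigenvector A a l" "eigenvector A e m" "eigenvector A r n"
    and "l \<noteq> m" "m \<noteq> n" "l \<noteq> n"
  obtains x y z where "v = x *s a + y *s e + z *s r"
proof -
  from eigenbasis_invertible[OF assms] obtain S where "cols3 a e r ** S = mat 1"
    by (auto simp: invertible_def)
  then have "v = cols3 a e r *v (S *v v)"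
    by (simp add: matrix_vector_mul_assoc)
  then show ?thesis
    using that unfolding cols3_mult by blast
qed

text \<open>The matrix of eigenvectors conjugates \<open>A\<close> to the diagonal matrix
  \<open>D\<close>.\<close>

lemma eigenbasis_det:
  fixes A :: "complex^3^3"
  assumes eig: "eigenvector A a l" "eigenvector A e m" "eigenvector A r n"
    and ne: "l \<noteq> m" "m \<noteq> n" "l \<noteq> n"
  shows "det A = l * m * n"
proof -
  define D :: "complex^3^3" where "D = (\<chi> i j. if i = j then vector [l, m, n] $ i else 0)"
  have A: "A *v a = l *s a" "A *v e = m *s e" "A *v r = n *s r"
    using eig by (auto simp: eigenvector_def)
  have D: "D *v x = vector [l * x $ 1, m * x $ 2, n * x $ 3]" for x
    by (simp add: D_def matrix_vector_mult_def sum_3 vec_eq_iff forall_3)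
  have "(A ** cols3 a e r) *v x = (cols3 a e r ** D) *v x" for x
    by (simp add: matrix_vector_mul_assoc[symmetric] cols3_mult D A
        matrix_vector_right_distrib vector_scalar_commute mult.commute)
  then have "A ** cols3 a e r = cols3 a e r ** D"
    by (simp add: matrix_eq)
  then have "det A * det (cols3 a e r) = det (cols3 a e r) * det D"
    by (metis det_mul)
  moreover have "det (cols3 a e r) \<noteq> 0"
    using eigenbasis_invertible[OF assms] by (simp add: invertible_det_nz)
  moreover have "det D = l * m * n"
    by (simp add: D_def det_3)
  ultimately show ?thesis by simp
qed

text \<open>An eigenvector for any fourth value would have all coordinates zero in the eigenbasis.
  Knowing the whole spectrum is what evaluates the \<open>THE\<close> descriptions of the extreme
  eigenvalues.\<close>

lemma eigenbasis_eigenvalue: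
  fixes A :: "complex^3^3"
  assumes eig: "eigenvector A a l" "eigenvector A e m" "eigenvector A r n"
    and ne: "l \<noteq> m" "m \<noteq> n" "l \<noteq> n"
    and k: "eigenvector A v k" "k \<noteq> l"
  obtains "k = m" | "k = n"
proof -
  obtain x y z where v: "v = x *s a + y *s e + z *s r"
    using eigenbasis_expand[OF eig ne] .
  have A: "A *v a = l *s a" "A *v e = m *s e" "A *v r = n *s r" "A *v v = k *s v" "v \<noteq> 0"
    using eig k by (auto simp: eigenvector_def)
  have "(x * (l - k)) *s a + (y * (m - k)) *s e + (z * (n - k)) *s r = A *v v - k *s v"
    unfolding v by (simp add: matrix_vector_right_distrib vector_scalar_commute A)
      (simp add: vec_eq_iff algebra_simps)
  also have "\<dots> = 0" by (simp add: A)
  finally have "x * (l - k) = 0 \<and> y * (m - k) = 0 \<and> z * (n - k) = 0"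
    by (rule eigenbasis_independent[OF eig ne])
  then show ?thesis
    using v A(5) k(2) that by auto
qed

text \<open>Invariance of \<open>herm\<close> lets eigenvectors for \<open>k\<close> and
  \<open>k'\<close> pair nontrivially only if \<open>k * cnj k' = 1\<close>. Nondegeneracy then
  pairs \<open>a\<close> with \<open>r\<close> and makes \<open>e\<close> orthogonal to both, so the
  two matrices agree on an eigenbasis.\<close>

lemma loxodromic_normal_form:
  assumes lox: "loxodromic A" and att: "attractive A a" and rep: "repulsive A r"
  defines "l \<equiv> max_eigenvalue A"
  shows "cmod l > 1" "herm a a = 0" "herm r r = 0" "herm a r \<noteq> 0"
    "A = lox_mat l ((1 / herm a r) *s a) r"
proof -
  obtain l' m n a' e r' where eig': "eigenvector A a' l'" "eigenvector A e m" "eigenvector A r' n"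
    and less: "cmod l' > cmod m" "cmod m > cmod n"
    using lox unfolding loxodromic_def eigenvalue_def by blast
  have ne: "l' \<noteq> m" "m \<noteq> n" "l' \<noteq> n"
    using less by auto
  have SU: "A \<in> SU_J"
    using lox by (simp add: loxodromic_def)
  have vals: "eigenvalue A k \<longleftrightarrow> k = l' \<or> k = m \<or> k = n" for k
  proof
    assume "eigenvalue A k"
    then obtain v where "eigenvector A v k" by (auto simp: eigenvalue_def)
    then show "k = l' \<or> k = m \<or> k = n"
      using eigenbasis_eigenvalue[OF eig' ne] by blast
  qed (use eig' in \<open>auto simp: eigenvalue_def\<close>)
  have "l' = l"
    unfolding l_def max_eigenvalue_def using less
    by (intro the_equality[symmetric]) (auto simp: vals)
  have "n = min_eigenvalue A"
    unfolding min_eigenvalue_def using less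
    by (intro the_equality[symmetric]) (auto simp: vals)
  with \<open>l' = l\<close> att rep eig' less ne
  have eig: "eigenvector A a l" "eigenvector A e m" "eigenvector A r n"
    and less: "cmod l > cmod m" "cmod m > cmod n" and ne: "l \<noteq> m" "m \<noteq> n" "l \<noteq> n"
    by (simp_all add: attractive_def repulsive_def l_def)
  have A: "A *v a = l *s a" "A *v e = m *s e" "A *v r = n *s r"
    and nz: "a \<noteq> 0" "e \<noteq> 0" "r \<noteq> 0"
    using eig by (auto simp: eigenvector_def)
  have prod: "l * m * n = 1"
    using eigenbasis_det[OF eig ne] SU by (simp add: SU_J_def)
  then have norms: "cmod l * cmod m * cmod n = 1"
    by (metis norm_mult norm_one)
  \<comment> \<open>Three strictly decreasing moduli with product 1 have the first above 1 and the
    last below 1.\<close>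
  have l1: "cmod l > 1"
  proof (rule ccontr)
    assume "\<not> cmod l > 1"
    with less have "cmod l * cmod m \<le> 1 * 1"
      by (intro mult_mono) auto
    then have "cmod l * cmod m * cmod n \<le> 1 * cmod n"
      by (intro mult_right_mono) auto
    with norms less \<open>\<not> cmod l > 1\<close> show False by linarith
  qed
  then have l0: "l \<noteq> 0" by auto
  have n1: "cmod n < 1"
  proof (rule ccontr)
    assume "\<not> cmod n < 1"
    then have "1 * 1 < cmod l * cmod m"
      using less l1 by (intro mult_strict_mono) auto
    then have "1 * 1 < cmod l * cmod m * cmod n"
      using \<open>\<not> cmod n < 1\<close> by (intro mult_less_le_imp_less) auto
    with norms show False by simp
  qed
  have orth: "v \<in> {a, e, r} \<Longrightarrow> herm v a = 0 \<Longrightarrow> herm v e = 0 \<Longrightarrow> herm v r = 0 \<Longrightarrow> False" for v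
  proof -
    assume v: "v \<in> {a, e, r}" "herm v a = 0" "herm v e = 0" "herm v r = 0"
    have "herm v w = 0" for w
    proof -
      obtain x y z where "w = x *s a + y *s e + z *s r"
        using eigenbasis_expand[OF eig ne] .
      then show ?thesis using v by (simp add: herm_linear)
    qed
    then show False
      using herm_nondegenerate[of v] v nz by auto
  qed
  have pair: "herm v w = 0 \<or> k * cnj k' = 1" if "A *v v = k *s v" "A *v w = k' *s w" for v w k k'
    using SU_J_herm[OF SU, of v w] that by (auto simp: herm_linear mult.commute)
  have nocirc: "herm v v = 0" if "A *v v = k *s v" "cmod k \<noteq> 1" for v k
  proof -
    have "k * cnj k \<noteq> 1"
    proof
      assume "k * cnj k = 1"
      then have "(cmod k)\<^sup>2 = 1"
        by (metis complex_mod_cnj norm_mult norm_one power2_eq_square)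
      then have "cmod k = 1"
        using norm_ge_zero[of k] by (auto simp: power2_eq_1_iff)
      with that(2) show False by simp
    qed
    then show ?thesis using pair[OF that(1,1)] by auto
  qed
  show "cmod l > 1" by (fact l1)
  show aa: "herm a a = 0" using nocirc[OF A(1)] l1 by simp
  show rr: "herm r r = 0" using nocirc[OF A(3)] n1 by simp
  \<comment> \<open>Otherwise \<open>a\<close> could pair only with \<open>e\<close>, forcing
    \<open>cmod m < 1\<close>; then \<open>cmod n * cmod m < 1\<close> leaves \<open>r\<close>
    orthogonal to the whole eigenbasis.\<close>
  show ar: "herm a r \<noteq> 0"
  proof
    assume ar: "herm a r = 0"
    then have ra: "herm r a = 0" using herm_cnj[of a r] by simp
    have "herm a e \<noteq> 0" using orth[of a] aa ar by auto
    then have "l * cnj m = 1" using pair[OF A(1,2)] by auto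
    then have "cmod l * cmod m = 1" by (metis complex_mod_cnj norm_mult norm_one)
    then have "cmod m = 1 / cmod l"
      using l1 by (intro eq_divide_imp) (auto simp: mult.commute)
    then have "cmod m < 1"
      using l1 l0 by simp
    then have "cmod n * cmod m \<le> 1 * cmod m"
      using n1 by (intro mult_right_mono) auto
    with \<open>cmod m < 1\<close> have "cmod n * cmod m < 1" by simp
    then have "n * cnj m \<noteq> 1"
      by (metis complex_mod_cnj norm_mult norm_one less_irrefl)
    then have "herm r e = 0" using pair[OF A(3,2)] by auto
    then show False using orth[of r] rr ra by auto
  qed
  have n: "n = 1 / cnj l"
  proof -
    have "n * cnj l = 1"
      using pair[OF A(3,1)] ar herm_cnj[of r a] by auto
    then show ?thesis
      by (intro eq_divide_imp) auto
  qed
  have m: "m = mid_eig l"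
    using prod l0 by (simp add: n mid_eig_def field_simps)
  have "cmod m = 1"
    using l0 by (simp add: m mid_eig_def norm_divide)
  then have "cmod (l * cnj m) \<noteq> 1" "cmod (n * cnj m) \<noteq> 1"
    using l1 n1 by (simp_all add: norm_mult)
  then have ae: "herm a e = 0" and re: "herm r e = 0"
    using pair[OF A(1,2)] pair[OF A(3,2)] by auto
  have e: "herm e a = 0" "herm e r = 0"
    using ae re herm_cnj[of a e] herm_cnj[of r e] by auto
  have ra: "herm r a \<noteq> 0" "cnj (herm a r) = herm r a"
    using ar herm_cnj[of a r] herm_cnj[of r a] by auto
  have "A *v v = lox_mat l ((1 / herm a r) *s a) r *v v" for v
  proof -
    obtain x y z where v: "v = x *s a + y *s e + z *s r"
      using eigenbasis_expand[OF eig ne] .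
    have "A *v v = (x * l) *s a + (y * m) *s e + (z * n) *s r"
      unfolding v by (simp add: matrix_vector_right_distrib vector_scalar_commute A)
    moreover have "lox_mat l ((1 / herm a r) *s a) r *v v
        = (x * l) *s a + (y * m) *s e + (z * n) *s r"
      unfolding lox_mat_mult v using ar ra
      by (simp add: herm_linear aa rr e att_coeff_def rep_coeff_def m[symmetric] n[symmetric])
        (simp add: vec_eq_iff algebra_simps)
    ultimately show ?thesis by simp
  qed
  then show "A = lox_mat l ((1 / herm a r) *s a) r"
    by (simp add: matrix_eq)
qed

section \<open>Commutators in SU(J)\<close>

lemma SU_J_matrix_inv:
  assumes "A \<in> SU_J"
  shows "matrix_inv A \<in> SU_J"
proof -
  let ?I = "matrix_inv A"
  note inv = SU_J_inv_both[OF assms]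
  have adj1: "adjoint_mat (mat 1 :: complex^3^3) = mat 1"
    by (simp add: adjoint_mat_def mat_def vec_eq_iff)
  have "adjoint_mat ?I ** J_mat ** ?I = adjoint_mat ?I ** (adjoint_mat A ** J_mat ** A) ** ?I"
    using assms by (simp add: SU_J_def)
  also have "\<dots> = adjoint_mat (A ** ?I) ** J_mat ** (A ** ?I)"
    by (simp add: adjoint_mat_mult matrix_mul_assoc)
  also have "\<dots> = J_mat"
    by (simp add: inv adj1)
  finally have "adjoint_mat ?I ** J_mat ** ?I = J_mat" .
  moreover have "det ?I * det A = 1"
    using inv(1) by (metis det_mul det_I)
  ultimately show ?thesis
    using assms by (simp add: SU_J_def)
qed

text \<open>\<open>[B, A]\<close> is the inverse of \<open>[A, B]\<close>, so
  \<open>trace_SU_J_inv\<close> applies.\<close>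

lemma trace_commutator_swap:
  assumes "A \<in> SU_J" "B \<in> SU_J"
  shows "trace (commutator B A) = cnj (trace (commutator A B))"
proof -
  have cancel: "matrix_inv A ** (A ** Y) = Y" "A ** (matrix_inv A ** Y) = Y"
    "matrix_inv B ** (B ** Y) = Y" for Y
    using SU_J_inv_both[OF assms(1)] SU_J_inv_both[OF assms(2)] by (simp_all add: matrix_mul_assoc)
  have "commutator B A ** commutator A B = mat 1"
    unfolding commutator_def matrix_mul_assoc[symmetric]
    by (simp only: cancel SU_J_inv_both[OF assms(2)])
  then have "matrix_inv (commutator A B) = commutator B A"
    by (rule matrix_inv_eqI)
  moreover have "commutator A B \<in> SU_J"
    unfolding commutator_def by (intro SU_J_mult SU_J_matrix_inv assms)
  ultimately show ?thesis
    using trace_SU_J_inv by metis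
qed

section \<open>Eigenvalues and cross-ratios from traces\<close>

definition trace_lox :: "complex \<Rightarrow> complex" where
  "trace_lox l = l + mid_eig l + 1 / cnj l"

text \<open>The formula of \<open>trace_lox_mat_mult\<close> for normalized pairs, with the products
  of form values abbreviated by \<open>x\<close>, \<open>y\<close> (in the role of
  \<open>X1\<close>, \<open>X2\<close>) and their conjugates.\<close>

definition trace_prod :: "complex \<Rightarrow> complex \<Rightarrow> complex \<Rightarrow> complex \<Rightarrow> complex" where
  "trace_prod l k x y =
     3 * mid_eig l * mid_eig k
     + mid_eig k * (att_coeff l + rep_coeff l) + mid_eig l * (att_coeff k + rep_coeff k)
     + att_coeff l * att_coeff k * cnj x + rep_coeff l * rep_coeff k * x
     + att_coeff l * rep_coeff k * y + rep_coeff l * att_coeff k * cnj y"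

text \<open>The eigenvalues have product 1 and their pairwise products sum to the conjugate trace,
  so the trace fixes the characteristic polynomial. Its roots other than \<open>l\<close> lie in the
  closed unit disc.\<close>

lemma trace_lox_inj:
  assumes l: "cmod l > 1" and k: "cmod k > 1" and eq: "trace_lox l = trace_lox k"
  shows "l = k"
proof -
  have root: "(z - l) * (z - mid_eig l) * (z - 1 / cnj l)
      = z ^ 3 - trace_lox l * z\<^sup>2 + cnj (trace_lox l) * z - 1" if "cmod l > 1" for l z
  proof -
    have "l \<noteq> 0" using that by auto
    then have e: "l * mid_eig l + l * (1 / cnj l) + mid_eig l * (1 / cnj l) = cnj (trace_lox l)"
      "l * mid_eig l * (1 / cnj l) = 1"
      by (simp_all add: trace_lox_def mid_eig_def)
    have "(z - l) * (z - m) * (z - n)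
        = z ^ 3 - (l + m + n) * z\<^sup>2 + (l * m + l * n + m * n) * z - l * m * n" for m n
      by (simp add: power2_eq_square power3_eq_cube algebra_simps)
    from this[of "mid_eig l" "1 / cnj l"] show ?thesis
      unfolding e trace_lox_def[symmetric] .
  qed
  have "(k - l) * (k - mid_eig l) * (k - 1 / cnj l) = 0"
    using root[OF l, of k] root[OF k, of k] eq by simp
  moreover have "k \<noteq> mid_eig l"
  proof
    assume "k = mid_eig l"
    then have "cmod k \<le> 1"
      by (simp add: mid_eig_def norm_divide)
    with k show False by simp
  qed
  moreover have "k \<noteq> 1 / cnj l"
  proof
    assume "k = 1 / cnj l"
    then have "cmod k = 1 / cmod l"
      by (simp add: norm_divide)
    also have "\<dots> < 1"
      using l by (subst divide_less_eq_1_pos) auto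
    finally show False using k by simp
  qed
  ultimately show ?thesis by simp
qed

text \<open>The two coefficients have moduli in the ratio \<open>cmod l\<close>, and
  \<open>rep_coeff l\<close> is nonzero because the eigenvalues it subtracts have different
  moduli.\<close>

lemma coeff_weight_pos:
  assumes "cmod l > 1"
  shows "(cmod (rep_coeff l))\<^sup>2 < (cmod (att_coeff l))\<^sup>2"
proof -
  have l0: "l \<noteq> 0" using assms by auto
  have "cnj (att_coeff l) = - (l * rep_coeff l)"
    using l0 by (simp add: att_coeff_def rep_coeff_def mid_eig_def field_simps)
  then have eq: "cmod (att_coeff l) = cmod l * cmod (rep_coeff l)"
    by (metis complex_mod_cnj norm_minus_cancel norm_mult)
  have "rep_coeff l \<noteq> 0"
  proof
    assume "rep_coeff l = 0"
    then have "1 / cnj l = cnj l / l"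
      by (simp add: rep_coeff_def mid_eig_def)
    then have "cmod (1 / cnj l) = cmod (cnj l / l)"
      by simp
    then have "1 / cmod l = 1"
      using l0 by (simp add: norm_divide)
    with assms show False by simp
  qed
  then have "1 * cmod (rep_coeff l) < cmod l * cmod (rep_coeff l)"
    using assms by (intro mult_strict_right_mono) auto
  then show ?thesis
    unfolding eq by (intro power_strict_mono) auto
qed

lemma coeff_weight_neq_0:
  assumes "cmod l > 1"
  shows "att_coeff l * cnj (att_coeff l) - rep_coeff l * cnj (rep_coeff l) \<noteq> 0"
  using coeff_weight_pos[OF assms]
  by (metis complex_norm_square eq_iff_diff_eq_0 less_irrefl of_real_eq_iff)

text \<open>Cramer's rule; the first hypothesis is that the determinant is nonzero.\<close>

lemma cnj_cancel_system:
  assumes "p * cnj p - q * cnj q \<noteq> 0" "p * u + q * v = 0" "cnj q * u + cnj p * v = 0"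
  shows "u = 0" "v = 0"
proof -
  have "(p * cnj p - q * cnj q) * u = cnj p * (p * u + q * v) - q * (cnj q * u + cnj p * v)"
    by (simp add: algebra_simps)
  then show "u = 0" using assms by simp
  have "(p * cnj p - q * cnj q) * v = p * (cnj q * u + cnj p * v) - cnj q * (p * u + q * v)"
    by (simp add: algebra_simps)
  then show "v = 0" using assms by simp
qed

text \<open>The real-linear system factors: a system with the coefficients of \<open>l\<close> kills
  \<open>u\<close> and \<open>v\<close>, and then one with the coefficients of \<open>k\<close>
  kills the differences.\<close>

lemma trace_prod_inj:
  assumes l: "cmod l > 1" and k: "cmod k > 1"
    and eq: "trace_prod l k x y = trace_prod l k x' y'"
      "trace_prod (1 / l) k x y = trace_prod (1 / l) k x' y'"
  shows "x = x'" "y = y'"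
proof -
  have l0: "l \<noteq> 0" using l by auto
  define u v where "u = att_coeff k * cnj (x - x') + rep_coeff k * (y - y')"
    and "v = rep_coeff k * (x - x') + att_coeff k * cnj (y - y')"
  have "att_coeff l * u + rep_coeff l * v = trace_prod l k x y - trace_prod l k x' y'"
    by (simp add: u_def v_def trace_prod_def algebra_simps)
  then have e1: "att_coeff l * u + rep_coeff l * v = 0"
    by (simp only: eq diff_self)
  have "cnj (rep_coeff l) * u + cnj (att_coeff l) * v
      = trace_prod (1 / l) k x y - trace_prod (1 / l) k x' y'"
    by (simp add: u_def v_def trace_prod_def coeff_inverse[OF l0] algebra_simps)
  then have e2: "cnj (rep_coeff l) * u + cnj (att_coeff l) * v = 0"
    by (simp only: eq diff_self)
  note uv = cnj_cancel_system[OF coeff_weight_neq_0[OF l] e1 e2]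
  have e3: "att_coeff k * cnj (x - x') + rep_coeff k * (y - y') = 0"
    using uv(1) by (simp only: u_def)
  \<comment> \<open>Conjugating \<open>v\<close> expresses it in the same unknowns as
    \<open>u\<close>, namely \<open>cnj (x - x')\<close> and \<open>y - y'\<close>.\<close>
  have "cnj (rep_coeff k) * cnj (x - x') + cnj (att_coeff k) * (y - y') = cnj v"
    by (simp add: v_def)
  then have e4: "cnj (rep_coeff k) * cnj (x - x') + cnj (att_coeff k) * (y - y') = 0"
    by (simp only: uv complex_cnj_zero)
  have "cnj (x - x') = 0" "y - y' = 0"
    by (rule cnj_cancel_system[OF coeff_weight_neq_0[OF k] e3 e4])+
  then show "x = x'" "y = y'" by (auto simp flip: complex_cnj_diff)
qed

text \<open>By \<open>coeff_inverse\<close> all terms without \<open>y\<close> are real or cancel in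
  conjugate pairs.\<close>

lemma trace_prod_inverse_Im:
  assumes "l \<noteq> 0"
  shows "Im (trace_prod l (1 / l) x y)
    = ((cmod (att_coeff l))\<^sup>2 - (cmod (rep_coeff l))\<^sup>2) * Im y"
  unfolding cmod_power2
  by (simp add: trace_prod_def coeff_inverse[OF assms] algebra_simps power2_eq_square)

lemma trace_prod_inverse_Re:
  assumes "l \<noteq> 0" "Re y = Re y'"
  shows "Re (trace_prod l (1 / l) x y) = Re (trace_prod l (1 / l) x y')"
  using assms(2) by (simp add: trace_prod_def coeff_inverse[OF assms(1)] algebra_simps)

section \<open>Null vectors and orthogonal complements\<close>

text \<open>The Gram determinant of \<open>u\<close>, \<open>v\<close> vanishes because the orthogonal complement of \<open>a\<close>, \<open>r\<close> is
  one-dimensional.\<close>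

lemma hyperbolic_pair_complement:
  assumes "herm a a = 0" "herm r r = 0" "herm a r = 1"
    and u: "herm u a = 0" "herm u r = 0" and v: "herm v a = 0" "herm v r = 0"
  shows "herm u u * herm v v = herm u v * herm v u"
proof -
  have ra: "herm r a = 1"
    using herm_cnj[of a r] assms by simp
  have perp: "x = 0 \<and> y = 0" if "w = x *s a + y *s r + z *s u" "herm w a = 0" "herm w r = 0" for x y z w
    using that assms ra by (simp add: herm_linear)
  show ?thesis
  proof (cases "\<exists>x. x \<noteq> 0 \<and> cols3 a r u *v x = 0")
    case True
    then obtain x :: "complex^3" where x: "x \<noteq> 0" "0 = x $ 1 *s a + x $ 2 *s r + x $ 3 *s u"
      by (auto simp: cols3_mult)
    have "x $ 1 = 0 \<and> x $ 2 = 0"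
      by (rule perp[OF x(2)]) (simp_all add: herm_expand)
    with x have "u = 0"
      by (auto simp: vec_eq_iff forall_3)
    then show ?thesis by (simp add: herm_expand)
  next
    case False
    then have "\<exists>S. S ** cols3 a r u = mat 1"
      using matrix_left_invertible_ker[of "cols3 a r u"] by auto
    then obtain S where "cols3 a r u ** S = mat 1"
      using matrix_left_right_inverse by blast
    then have "v = cols3 a r u *v (S *v v)"
      by (simp add: matrix_vector_mul_assoc)
    then obtain x y z where w: "v = x *s a + y *s r + z *s u"
      unfolding cols3_mult by blast
    with perp[OF w v] have "v = z *s u" by simp
    then show ?thesis by (simp add: herm_linear)
  qed
qed

text \<open>Isotropic subspaces have dimension at most one. This turns distinctness of fixed points
  into nonvanishing of form values.\<close>

lemma null_orthogonal_parallel: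
  assumes "herm a a = 0" "herm r r = 0" "herm a r = 1" "herm u u = 0" "herm u a = 0"
  shows "u = herm u r *s a"
proof -
  have ra: "herm r a = 1"
    using herm_cnj[of a r] assms by simp
  define w where "w = u - herm u r *s a"
  have au: "herm a u = 0" using herm_cnj[of u a] assms by simp
  have w: "herm w a = 0" "herm w r = 0" "herm w w = 0"
    using assms au by (simp_all add: w_def herm_linear)
  have "herm w v = 0" for v
  proof -
    define v' where "v' = v - herm v r *s a - herm v a *s r"
    have v': "herm v' a = 0" "herm v' r = 0"
      using assms ra by (simp_all add: v'_def herm_linear)
    \<comment> \<open>Since \<open>w\<close> is null, the vanishing Gram determinant makes it
      orthogonal to every \<open>v'\<close> in the complement of \<open>a\<close>,
      \<open>r\<close>.\<close>
    have "herm w v' * herm v' w = 0"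
      using hyperbolic_pair_complement[OF assms(1-3) w(1,2) v'] w(3) by simp
    then have "herm w v' = 0"
      using herm_cnj[of v' w] by auto
    then show ?thesis
      using w by (simp add: v'_def herm_linear)
  qed
  then have "w = 0" by (rule herm_nondegenerate)
  then show ?thesis by (simp add: w_def)
qed

section \<open>Pairs of loxodromic matrices\<close>

text \<open>Scaling the attractive eigenvectors so that \<open>herm a r = herm b s = 1\<close> makes the denominators
  of the first two cross-ratios equal to 1.\<close>

locale normalized_pair =
  fixes l k :: complex and a r b s :: "complex^3"
  assumes l: "cmod l > 1" and k: "cmod k > 1"
    and aa: "herm a a = 0" and rr: "herm r r = 0" and ar: "herm a r = 1"
    and bb: "herm b b = 0" and ss: "herm s s = 0" and bs: "herm b s = 1"
    and A_SU: "lox_mat l a r \<in> SU_J" and B_SU: "lox_mat k b s \<in> SU_J"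
    and sa: "herm s a \<noteq> 0" and br: "herm b r \<noteq> 0"
begin

abbreviation A where "A \<equiv> lox_mat l a r"
abbreviation B where "B \<equiv> lox_mat k b s"
abbreviation x1 where "x1 \<equiv> X1 a r b s"
abbreviation x2 where "x2 \<equiv> X2 a r b s"
abbreviation x3 where "x3 \<equiv> X3 a r b s"

lemma l0: "l \<noteq> 0"
  using l by auto

lemma ra: "herm r a = 1" and sb: "herm s b = 1"
  using herm_cnj[of a r] herm_cnj[of b s] ar bs by simp_all

lemma X_eqs: "x1 = herm r b * herm s a" "cnj x1 = herm b r * herm a s"
    "x2 = herm a b * herm s r" "cnj x2 = herm b a * herm r s"
  by (simp_all add: X1_def X2_def ar bs ra sb herm_cnj)

lemma trace_A: "trace A = trace_lox l" and trace_B: "trace B = trace_lox k"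
  by (simp_all add: trace_lox_mat trace_lox_def ar bs ra sb att_coeff_def rep_coeff_def)

lemma trace_AB: "trace (lox_mat l' a r ** lox_mat k' b s) = trace_prod l' k' x1 x2"
  unfolding trace_lox_mat_mult trace_prod_def X_eqs by (simp add: ar bs ra sb herm_cnj mult.commute)

lemma trace_params_eq:
  "trace_params A B = (trace_lox l, trace_lox k, cnj (trace_prod l k x1 x2),
     trace_prod (1 / l) k x1 x2 - cnj (trace_lox l) * trace_lox k)"
  using trace_SU_J_inv[OF A_SU] trace_SU_J_inv[OF SU_J_mult[OF A_SU B_SU]]
  by (simp add: trace_params_def sigma_plus_def trace_A trace_B trace_AB lox_mat_inv[OF l0 aa rr ar])

text \<open>The factor \<open>|X1|^2\<close> clears the denominators of \<open>X3\<close>, so that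
  \<open>Z\<close> is a product of four form values.\<close>

definition Z where "Z = x1 * cnj x1 * x3"

lemma Z_eq: "Z = herm r b * herm a s * herm b a * herm s r"
  using sa br by (simp add: Z_def X_eqs herm_cnj) (simp add: X3_def field_simps)

lemma cnj_Z_eq: "cnj Z = herm b r * herm s a * herm a b * herm r s"
  by (simp add: Z_eq herm_cnj)

lemma Im_Z: "Im Z = (cmod x1)\<^sup>2 * Im x3"
proof -
  have "Z = of_real ((cmod x1)\<^sup>2) * x3"
    by (simp only: Z_def complex_norm_square)
  then show ?thesis by simp
qed

text \<open>The relation \<open>|X2| = |X1| |X3|\<close>, squared and multiplied by
  \<open>|X1|^2\<close>.\<close>

lemma Z_norm: "Z * cnj Z = x1 * cnj x1 * x2 * cnj x2"
  unfolding cnj_Z_eq unfolding Z_eq X_eqs by (simp add: herm_cnj ac_simps)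

text \<open>This is the relation giving the real part of \<open>X3\<close>, obtained as a Gram
  determinant.\<close>

lemma Z_real_part:
  "Z + cnj Z = (1 - cnj x1 - cnj x2) * (1 - x1 - x2) - cnj x1 * x2 - x1 * cnj x2"
proof -
  \<comment> \<open>The projections of \<open>b\<close> and \<open>s\<close> to the orthogonal
    complement of \<open>a\<close>, \<open>r\<close>.\<close>
  define u v where "u = b - herm b r *s a - herm b a *s r"
    and "v = s - herm s r *s a - herm s a *s r"
  have perp: "herm u a = 0" "herm u r = 0" "herm v a = 0" "herm v r = 0"
    by (simp_all add: u_def v_def herm_linear aa rr ar ra)
  have "herm u u = - (herm b r * herm a b) - herm b a * herm r b"
    "herm v v = - (herm s r * herm a s) - herm s a * herm r s"
    "herm u v = 1 - herm b r * herm a s - herm b a * herm r s"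
    "herm v u = 1 - herm s r * herm a b - herm s a * herm r b"
    by (simp_all add: u_def v_def herm_linear aa rr ar ra bb ss bs sb herm_cnj)
  then have "(- (herm b r * herm a b) - herm b a * herm r b)
      * (- (herm s r * herm a s) - herm s a * herm r s)
      = (1 - herm b r * herm a s - herm b a * herm r s)
      * (1 - herm s r * herm a b - herm s a * herm r b)"
    using hyperbolic_pair_complement[OF aa rr ar perp] by simp
  then show ?thesis
    unfolding cnj_Z_eq unfolding Z_eq X_eqs by (simp add: herm_cnj algebra_simps)
qed

text \<open>This and \<open>commutator_y\<close> are \<open>X1\<close> and \<open>X2\<close> of
  \<open>a\<close>, \<open>r\<close> and their images under \<open>B\<close>. Only
  \<open>commutator_y\<close> involves \<open>X3\<close>, through \<open>Z\<close>.\<close>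

definition commutator_x where
  "commutator_x = (cnj (mid_eig k) + cnj (att_coeff k) * x1 + cnj (rep_coeff k) * cnj x2)
     * (mid_eig k + att_coeff k * cnj x2 + rep_coeff k * x1)"

definition commutator_y where
  "commutator_y = att_coeff k * cnj (att_coeff k) * cnj Z + rep_coeff k * cnj (rep_coeff k) * Z
     + att_coeff k * cnj (rep_coeff k) * cnj (x1 * x2) + rep_coeff k * cnj (att_coeff k) * (x1 * x2)"

text \<open>\<open>[A, B]\<close> is the product of \<open>A\<close> and the loxodromic map \<open>B A\<^sup>-\<^sup>1 B\<^sup>-\<^sup>1\<close>, whose fixed
  points are the images under \<open>B\<close> of those of \<open>A\<close>.\<close>

lemma trace_commutator:
  "trace (commutator A B) = trace_prod l (1 / l) commutator_x commutator_y"
proof -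
  have inv: "matrix_inv A = lox_mat (1 / l) a r"
    by (rule lox_mat_inv[OF l0 aa rr ar])
  have "commutator A B = A ** (B ** lox_mat (1 / l) a r ** matrix_inv B)"
    by (simp add: commutator_def inv matrix_mul_assoc)
  also have "\<dots> = A ** lox_mat (1 / l) (B *v a) (B *v r)"
    by (simp add: lox_mat_conj[OF B_SU])
  finally have com: "commutator A B = A ** lox_mat (1 / l) (B *v a) (B *v r)" .
  have h: "herm r (B *v a) = cnj (mid_eig k) + cnj (att_coeff k) * x1 + cnj (rep_coeff k) * cnj x2"
    "herm (B *v r) a = mid_eig k + att_coeff k * cnj x2 + rep_coeff k * x1"
    "herm (B *v a) r = mid_eig k + att_coeff k * cnj x1 + rep_coeff k * x2"
    "herm a (B *v r) = cnj (mid_eig k) + cnj (att_coeff k) * x2 + cnj (rep_coeff k) * cnj x1"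
    unfolding lox_mat_mult herm_linear X_eqs by (simp_all add: herm_cnj ar ra mult_ac)
  have y: "herm (B *v r) r * herm a (B *v a) = commutator_y"
    "herm (B *v a) a * herm r (B *v r) = cnj commutator_y"
    unfolding lox_mat_mult herm_linear commutator_y_def complex_cnj_add complex_cnj_mult complex_cnj_cnj
      cnj_Z_eq unfolding Z_eq X_eqs
    by (simp_all add: herm_cnj aa rr) (simp_all add: algebra_simps)
  have x: "herm (B *v r) a * herm r (B *v a) = commutator_x"
    "herm (B *v a) r * herm a (B *v r) = cnj commutator_x"
    unfolding h commutator_x_def by (simp_all add: algebra_simps)
  show ?thesis
    unfolding com trace_lox_mat_mult trace_prod_def SU_J_herm[OF B_SU] x y
    by (simp add: ar ra)
qed

text \<open>In \<open>commutator_y\<close> the two terms with \<open>x1 * x2\<close> are conjugate,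
  so only those with \<open>Z\<close> have an imaginary part to contribute.\<close>

lemma Im_trace_commutator:
  "Im (trace (commutator A B)) =
     - (((cmod (att_coeff l))\<^sup>2 - (cmod (rep_coeff l))\<^sup>2)
        * ((cmod (att_coeff k))\<^sup>2 - (cmod (rep_coeff k))\<^sup>2)) * Im Z"
proof -
  have "Im commutator_y = - ((cmod (att_coeff k))\<^sup>2 - (cmod (rep_coeff k))\<^sup>2) * Im Z"
    unfolding cmod_power2
    by (simp add: commutator_y_def algebra_simps power2_eq_square)
  then show ?thesis
    unfolding trace_commutator trace_prod_inverse_Im[OF l0]
    by (simp only: mult_minus_left mult_minus_right mult.assoc)
qed

lemma sgn_Im_trace_commutator: "sgn (Im x3) = - sgn (Im (trace (commutator A B)))"
proof -
  have "x1 \<noteq> 0"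
    using sa br herm_cnj[of b r] by (auto simp: X_eqs)
  then show ?thesis
    using coeff_weight_pos[OF l] coeff_weight_pos[OF k]
    by (simp add: Im_trace_commutator Im_Z sgn_mult)
qed

end

lemma commutator_quadratic_SU_J:
  assumes "A \<in> SU_J" "B \<in> SU_J"
  defines "t \<equiv> trace (commutator A B)"
  shows "commutator_quadratic A B = [: of_real ((Re t)\<^sup>2 + (Im t)\<^sup>2), - of_real (2 * Re t), 1 :]"
  unfolding commutator_quadratic_def trace_commutator_swap[OF assms(1,2)] t_def[symmetric]
  by (simp add: complex_eq_iff power2_eq_square)

text \<open>\<open>X1\<close> and \<open>X2\<close> give \<open>Re Z\<close> and \<open>|Z|\<close>,
  hence \<open>Z\<close> up to conjugation. That ambiguity only changes the sign of
  \<open>Im t\<close> for \<open>t = tr[A, B]\<close>, and the quadratic depends on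
  \<open>Re t\<close> and the square of \<open>Im t\<close>.\<close>

lemma commutator_quadratic_cong:
  assumes "normalized_pair l k a r b s" "normalized_pair l k a' r' b' s'"
    and "X1 a r b s = X1 a' r' b' s'" "X2 a r b s = X2 a' r' b' s'"
  shows "commutator_quadratic (lox_mat l a r) (lox_mat k b s)
       = commutator_quadratic (lox_mat l a' r') (lox_mat k b' s')"
proof -
  interpret P: normalized_pair l k a r b s by fact
  interpret P': normalized_pair l k a' r' b' s' by fact
  have "P.Z + cnj P.Z = P'.Z + cnj P'.Z"
    by (simp add: P.Z_real_part P'.Z_real_part assms)
  then have Re: "Re P.Z = Re P'.Z"
    by (simp add: complex_eq_iff)
  have "P.Z * cnj P.Z = P'.Z * cnj P'.Z"
    by (simp add: P.Z_norm P'.Z_norm assms)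
  then have "(Re P.Z)\<^sup>2 + (Im P.Z)\<^sup>2 = (Re P'.Z)\<^sup>2 + (Im P'.Z)\<^sup>2"
    by (simp add: complex_eq_iff power2_eq_square)
  with Re have Im: "(Im P.Z)\<^sup>2 = (Im P'.Z)\<^sup>2"
    by simp
  have "P.commutator_x = P'.commutator_x"
    by (simp add: P.commutator_x_def P'.commutator_x_def assms)
  moreover have "Re P.commutator_y = Re P'.commutator_y"
    using Re by (simp add: P.commutator_y_def P'.commutator_y_def assms algebra_simps)
  ultimately have "Re (trace (commutator P.A P.B)) = Re (trace (commutator P'.A P'.B))"
    using trace_prod_inverse_Re[OF P.l0]
    unfolding P.trace_commutator P'.trace_commutator by metis
  moreover have "(Im (trace (commutator P.A P.B)))\<^sup>2 = (Im (trace (commutator P'.A P'.B)))\<^sup>2"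
    by (simp add: P.Im_trace_commutator P'.Im_trace_commutator power_mult_distrib Im)
  ultimately show ?thesis
    by (simp add: commutator_quadratic_SU_J P.A_SU P.B_SU P'.A_SU P'.B_SU)
qed

section \<open>The parameter bijection\<close>

lemma proj_point_scale:
  assumes "v = c *s w" "v \<noteq> 0"
  shows "proj_point v = proj_point w"
proof -
  have "c \<noteq> 0" using assms by auto
  have "v \<in> vec.span {w}"
    unfolding assms(1) by (intro vec.span_scale vec.span_base) simp
  moreover have "w = (1 / c) *s v"
    using \<open>c \<noteq> 0\<close> by (simp add: assms(1))
  then have "w \<in> vec.span {v}"
    by (metis insertI1 vec.span_base vec.span_scale)
  ultimately show ?thesis
    unfolding proj_point_def by (intro antisym vec.span_minimal) auto
qed

text \<open>Rescaling eigenvectors cancels in each cross-ratio. A vanishing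
  \<open>herm rB aA\<close> or \<open>herm aB rA\<close> would make two fixed points
  coincide.\<close>

lemma lox_pair_normalize:
  assumes "lox_pair A B aA rA aB rB"
  obtains a b where "normalized_pair (max_eigenvalue A) (max_eigenvalue B) a rA b rB"
    "A = lox_mat (max_eigenvalue A) a rA" "B = lox_mat (max_eigenvalue B) b rB"
    "X1 a rA b rB = X1 aA rA aB rB" "X2 a rA b rB = X2 aA rA aB rB" "X3 a rA b rB = X3 aA rA aB rB"
proof -
  have h: "loxodromic A" "loxodromic B" "attractive A aA" "repulsive A rA" "attractive B aB"
      "repulsive B rB"
    and dist: "proj_point aA \<noteq> proj_point rB" "proj_point rA \<noteq> proj_point aB"
    using assms by (auto simp: lox_pair_def)
  note nA = loxodromic_normal_form[OF h(1,3,4)] and nB = loxodromic_normal_form[OF h(2,5,6)]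
  have nz: "aA \<noteq> 0" "rA \<noteq> 0" "aB \<noteq> 0" "rB \<noteq> 0"
    using h by (auto simp: attractive_def repulsive_def eigenvector_def)
  define c d where "c = 1 / herm aA rA" and "d = 1 / herm aB rB"
  have cd: "c \<noteq> 0" "d \<noteq> 0"
    using nA(4) nB(4) by (simp_all add: c_def d_def)
  have null: "herm (c *s aA) (c *s aA) = 0" "herm (c *s aA) rA = 1"
    "herm (d *s aB) (d *s aB) = 0" "herm (d *s aB) rB = 1"
    using nA(2,4) nB(2,4) by (simp_all add: herm_linear c_def d_def)
  have sa: "herm rB (c *s aA) \<noteq> 0"
  proof
    assume "herm rB (c *s aA) = 0"
    then have "rB = herm rB rA *s (c *s aA)"
      using null_orthogonal_parallel[OF null(1) nA(3) null(2) nB(3)] by simp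
    then have "rB = (herm rB rA * c) *s aA"
      by (simp add: vector_smult_assoc)
    with dist(1) nz show False
      using proj_point_scale[of rB] by metis
  qed
  have br: "herm (d *s aB) rA \<noteq> 0"
  proof
    assume "herm (d *s aB) rA = 0"
    then have "herm rA (d *s aB) = 0"
      using herm_cnj[of "d *s aB" rA] by simp
    then have "rA = herm rA rB *s (d *s aB)"
      using null_orthogonal_parallel[OF null(3) nB(3) null(4) nA(3)] by simp
    then have "rA = (herm rA rB * d) *s aB"
      by (simp add: vector_smult_assoc)
    with dist(2) nz show False
      using proj_point_scale[of rA] by metis
  qed
  have eqs: "A = lox_mat (max_eigenvalue A) (c *s aA) rA" "B = lox_mat (max_eigenvalue B) (d *s aB) rB"
    using nA(5) nB(5) by (simp_all add: c_def d_def)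
  have "normalized_pair (max_eigenvalue A) (max_eigenvalue B) (c *s aA) rA (d *s aB) rB"
    using nA(1,3) nB(1,3) null sa br h(1,2) eqs
    by unfold_locales (simp_all add: loxodromic_def)
  then show ?thesis
    using cd eqs
    by (intro that[of "c *s aA" "d *s aB"]) (simp_all add: X1_def X2_def X3_def herm_scale)
qed

definition trace_coords :: "complex \<Rightarrow> complex \<Rightarrow> complex \<times> complex \<Rightarrow> complex \<times> complex" where
  "trace_coords l k = (\<lambda>(x, y). (cnj (trace_prod l k x y),
     trace_prod (1 / l) k x y - cnj (trace_lox l) * trace_lox k))"

text \<open>The triangular shape encodes dependence on the eigenvalues only: each leading eigenvalue
  is mapped by itself, and the pair fixes the map on the cross-ratios.\<close>

definition params_map ::
  "complex \<times> complex \<times> complex \<times> complex \<Rightarrow> complex \<times> complex \<times> complex \<times> complex" where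
  "params_map = (\<lambda>(l, k, z). (trace_lox l, trace_lox k, trace_coords l k z))"

lemma params_map_cross_ratio_params:
  assumes "lox_pair A B aA rA aB rB"
  shows "params_map (cross_ratio_params A B aA rA aB rB) = trace_params A B"
proof -
  obtain a b where n: "normalized_pair (max_eigenvalue A) (max_eigenvalue B) a rA b rB"
    and "A = lox_mat (max_eigenvalue A) a rA" "B = lox_mat (max_eigenvalue B) b rB"
    and "X1 a rA b rB = X1 aA rA aB rB" "X2 a rA b rB = X2 aA rA aB rB"
    using lox_pair_normalize[OF assms] by metis
  then show ?thesis
    using normalized_pair.trace_params_eq[OF n]
    by (simp add: params_map_def trace_coords_def cross_ratio_params_def)
qed

lemma params_map_inj: "inj_on params_map cross_ratio_values"
proof (rule inj_onI)
  fix u v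
  assume uv: "u \<in> cross_ratio_values" "v \<in> cross_ratio_values" "params_map u = params_map v"
  have lox: "\<exists>l k x y. u = (l, k, x, y) \<and> cmod l > 1 \<and> cmod k > 1" if "u \<in> cross_ratio_values" for u
    using that loxodromic_normal_form(1)
    by (fastforce simp: cross_ratio_values_def lox_pair_def cross_ratio_params_def)
  obtain l k x y where u: "u = (l, k, x, y)" "cmod l > 1" "cmod k > 1"
    using lox[OF uv(1)] by blast
  obtain l' k' x' y' where v: "v = (l', k', x', y')" "cmod l' > 1" "cmod k' > 1"
    using lox[OF uv(2)] by blast
  have "trace_lox l = trace_lox l'" "trace_lox k = trace_lox k'"
    using uv(3) by (simp_all add: u v params_map_def)
  then have "l' = l" "k' = k"
    using trace_lox_inj u v by metis+
  moreover have "x = x'" "y = y'"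
    using uv(3) trace_prod_inj[OF u(2,3), of x y x' y']
    by (simp_all add: u(1) v(1) params_map_def trace_coords_def \<open>l' = l\<close> \<open>k' = k\<close>)
  ultimately show "u = v" using u v by simp
qed

lemma cross_ratio_params_in_values:
  "lox_pair A B aA rA aB rB \<Longrightarrow> cross_ratio_params A B aA rA aB rB \<in> cross_ratio_values"
  unfolding cross_ratio_values_def by blast

lemma params_map_image: "params_map ` cross_ratio_values = trace_values"
proof
  show "params_map ` cross_ratio_values \<subseteq> trace_values"
    unfolding cross_ratio_values_def trace_values_def
    using params_map_cross_ratio_params by fastforce
  show "trace_values \<subseteq> params_map ` cross_ratio_values"
  proof
    fix q assume "q \<in> trace_values"
    then obtain A B aA rA aB rB where w: "lox_pair A B aA rA aB rB" "q = trace_params A B"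
      unfolding trace_values_def by blast
    then show "q \<in> params_map ` cross_ratio_values"
      using params_map_cross_ratio_params[OF w(1)] cross_ratio_params_in_values by (metis image_eqI)
  qed
qed

text \<open>Injectivity of \<open>params_map\<close> recovers eigenvalues and cross-ratios from the
  traces, which reduces the claim to \<open>commutator_quadratic_cong\<close>.\<close>

lemma trace_params_determine:
  assumes "lox_pair A B aA rA aB rB" "lox_pair A' B' aA' rA' aB' rB'"
    and "trace_params A B = trace_params A' B'"
  shows "commutator_quadratic A B = commutator_quadratic A' B'"
proof -
  have "cross_ratio_params A B aA rA aB rB = cross_ratio_params A' B' aA' rA' aB' rB'"
  proof (rule inj_onD[OF params_map_inj])
    show "params_map (cross_ratio_params A B aA rA aB rB)
        = params_map (cross_ratio_params A' B' aA' rA' aB' rB')"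
      by (simp only: params_map_cross_ratio_params[OF assms(1)]
          params_map_cross_ratio_params[OF assms(2)] assms(3))
  qed (intro cross_ratio_params_in_values assms)+
  then have eq: "max_eigenvalue A' = max_eigenvalue A" "max_eigenvalue B' = max_eigenvalue B"
    "X1 aA rA aB rB = X1 aA' rA' aB' rB'" "X2 aA rA aB rB = X2 aA' rA' aB' rB'"
    by (simp_all add: cross_ratio_params_def)
  obtain a b where n: "normalized_pair (max_eigenvalue A) (max_eigenvalue B) a rA b rB"
    and A: "A = lox_mat (max_eigenvalue A) a rA" and B: "B = lox_mat (max_eigenvalue B) b rB"
    and X: "X1 a rA b rB = X1 aA rA aB rB" "X2 a rA b rB = X2 aA rA aB rB"
    using lox_pair_normalize[OF assms(1)] by metis
  obtain a' b' where n': "normalized_pair (max_eigenvalue A) (max_eigenvalue B) a' rA' b' rB'"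
    and A': "A' = lox_mat (max_eigenvalue A) a' rA'" and B': "B' = lox_mat (max_eigenvalue B) b' rB'"
    and X': "X1 a' rA' b' rB' = X1 aA' rA' aB' rB'" "X2 a' rA' b' rB' = X2 aA' rA' aB' rB'"
    using lox_pair_normalize[OF assms(2)] unfolding eq by metis
  show ?thesis
    using commutator_quadratic_cong[OF n n'] eq X X' A B A' B' by metis
qed

lemma sgn_Im_X3:
  assumes "lox_pair A B aA rA aB rB"
  shows "sgn (Im (X3 aA rA aB rB)) = - sgn (Im (trace (commutator A B)))"
  using lox_pair_normalize[OF assms] normalized_pair.sgn_Im_trace_commutator by metis

theorem proposition7p1:
  shows "(\<exists>(t :: complex \<Rightarrow> complex)
             (\<Phi> :: complex \<Rightarrow> complex \<Rightarrow> complex \<times> complex \<Rightarrow> complex \<times> complex)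
             (F :: complex \<times> complex \<times> complex \<times> complex \<Rightarrow> complex \<times> complex \<times> complex \<times> complex).
            (\<forall>lA lB x1 x2. F (lA, lB, x1, x2) = (t lA, t lB, \<Phi> lA lB (x1, x2))) \<and>
            bij_betw F cross_ratio_values trace_values \<and>
            (\<forall>A B aA rA aB rB. lox_pair A B aA rA aB rB \<longrightarrow>
               F (cross_ratio_params A B aA rA aB rB) = trace_params A B))
       \<and> (\<forall>q \<in> trace_values. \<exists>(Q :: complex poly) (s :: complex \<Rightarrow> real).
            \<forall>A B aA rA aB rB. lox_pair A B aA rA aB rB \<and> trace_params A B = q \<longrightarrow>
               commutator_quadratic A B = Q \<and>
               poly Q (trace (commutator A B)) = 0 \<and>
               sgn (Im (X3 aA rA aB rB)) = s (trace (commutator A B)))"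
proof
  have "\<forall>lA lB x1 x2. params_map (lA, lB, x1, x2)
      = (trace_lox lA, trace_lox lB, trace_coords lA lB (x1, x2))"
    by (simp add: params_map_def)
  moreover have "bij_betw params_map cross_ratio_values trace_values"
    by (simp add: bij_betw_def params_map_inj params_map_image)
  ultimately show "\<exists>(t :: complex \<Rightarrow> complex)
             (\<Phi> :: complex \<Rightarrow> complex \<Rightarrow> complex \<times> complex \<Rightarrow> complex \<times> complex)
             (F :: complex \<times> complex \<times> complex \<times> complex \<Rightarrow> complex \<times> complex \<times> complex \<times> complex).
            (\<forall>lA lB x1 x2. F (lA, lB, x1, x2) = (t lA, t lB, \<Phi> lA lB (x1, x2))) \<and>
            bij_betw F cross_ratio_values trace_values \<and>
            (\<forall>A B aA rA aB rB. lox_pair A B aA rA aB rB \<longrightarrow>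
               F (cross_ratio_params A B aA rA aB rB) = trace_params A B)"
    using params_map_cross_ratio_params by blast
next
  have root: "poly (commutator_quadratic A B) (trace (commutator A B)) = 0" for A B
    by (simp add: commutator_quadratic_def algebra_simps)
  show "\<forall>q \<in> trace_values. \<exists>(Q :: complex poly) (s :: complex \<Rightarrow> real).
            \<forall>A B aA rA aB rB. lox_pair A B aA rA aB rB \<and> trace_params A B = q \<longrightarrow>
               commutator_quadratic A B = Q \<and>
               poly Q (trace (commutator A B)) = 0 \<and>
               sgn (Im (X3 aA rA aB rB)) = s (trace (commutator A B))"
  proof
    fix q assume "q \<in> trace_values"
    then obtain A B aA rA aB rB where w: "lox_pair A B aA rA aB rB" "q = trace_params A B"
      unfolding trace_values_def by blast
    have "commutator_quadratic A' B' = commutator_quadratic A B \<and>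
        poly (commutator_quadratic A B) (trace (commutator A' B')) = 0 \<and>
        sgn (Im (X3 aA' rA' aB' rB')) = - sgn (Im (trace (commutator A' B')))"
      if "lox_pair A' B' aA' rA' aB' rB'" "trace_params A' B' = q" for A' B' aA' rA' aB' rB'
    proof -
      have "commutator_quadratic A' B' = commutator_quadratic A B"
        using trace_params_determine[OF that(1) w(1)] that(2) w(2) by simp
      then show ?thesis
        using root[of A' B'] sgn_Im_X3[OF that(1)] by simp
    qed
    then show "\<exists>(Q :: complex poly) (s :: complex \<Rightarrow> real).
            \<forall>A B aA rA aB rB. lox_pair A B aA rA aB rB \<and> trace_params A B = q \<longrightarrow>
               commutator_quadratic A B = Q \<and>
               poly Q (trace (commutator A B)) = 0 \<and>
               sgn (Im (X3 aA rA aB rB)) = s (trace (commutator A B))"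
      \<comment> \<open>The quadratic of one pair serves all pairs with the same parameters; the
        sign is read off the chosen root \<open>tr[A, B]\<close>.\<close>
      by (intro exI[of _ "commutator_quadratic A B"] exI[of _ "\<lambda>z. - sgn (Im z)"]) blast
  qed
qed

end
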